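(* For every positive integer $r$, the probability $p_n$ that a uniformly random labeled graph of size $n$ is connected satisfies, as $n\to\infty$ (with $r$ fixed), $$p_n = 1 - \sum_{k=1}^{r-1} i_k \binom{n}{k} \frac{2^{k(k+1)/2}}{2^{nk}} + O\left(\frac{n^r}{2^{nr}}\right),$$ where $i_k$ is the number of irreducible labeled tournaments of size $k$.
   Context: A labeled graph of size $n$ is an undirected simple graph on the vertex set $\{1,\ldots,n\}$; there are $2^{\binom n2}$ of them, and a random graph of size $n$ is chosen uniformly, each graph having probability $1/2^{\binom n2}$ (the Erdős–Rényi model $G(n,1/2)$). Thus $p_n = c_n/2^{\binom n2}$, where $c_n$ is the number of connected labeled graphs of size $n$. A labeled tournament of size $k$ is a tournament on the vertex set $\{1,\ldots,k\}$, i.e. a directed graph in which every pair of distinct vertices is joined by exactly one directed edge (and there are no loops). A tournament (with at least one vertex) is irreducible if for every partition $A\sqcup B$ of its vertex set into two nonempty parts there exist an edge from $A$ to $B$ and an edge from $B$ to $A$ (equivalently, it is strongly connected). In particular the one-vertex tournament is irreducible. The constant implied by $O(\cdot)$ may depend on $r$. An empty sum is $0$. *)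

theory Defs
  imports
    "HOL-Probability.Probability_Mass_Function"
    "HOL-Library.Landau_Symbols"
    "Graph_Theory.Graph_Theory"
begin

text \<open>
  A simple undirected graph is represented by its symmetric loop-free digraph without parallel
  arcs, an edge between \<open>u\<close> and \<open>v\<close> being the pair of arcs \<open>(u, v)\<close>, \<open>(v, u)\<close>.  Each graph has
  exactly one such representation, so counting and the uniform distribution are unaffected
  (see \<open>card_labeled_graphs\<close> below).
\<close>

definition labeled_graphs :: "nat \<Rightarrow> nat pair_pre_digraph set" where
  "labeled_graphs n = {G. pair_graph G \<and> pverts G = {1..n}}"

text \<open>
  The name \<open>connected\<close> is qualified to distinguish it from topological connectedness.
\<close>

definition connected_prob :: "nat \<Rightarrow> real" where
  "connected_prob n =
     measure_pmf.prob (pmf_of_set (labeled_graphs n)) {G. Digraph_Component.connected (with_proj G)}"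

locale tournament = pair_digraph G for G :: "'a pair_pre_digraph" +
  assumes unique_arc:
    "\<lbrakk>u \<in> pverts G; v \<in> pverts G; u \<noteq> v\<rbrakk> \<Longrightarrow> (u, v) \<in> parcs G \<longleftrightarrow> (v, u) \<notin> parcs G"

definition irreducible_tournament :: "'a pair_pre_digraph \<Rightarrow> bool" where
  "irreducible_tournament G \<longleftrightarrow>
     tournament G \<and> pverts G \<noteq> {} \<and>
     (\<forall>A B. A \<union> B = pverts G \<and> A \<inter> B = {} \<and> A \<noteq> {} \<and> B \<noteq> {} \<longrightarrow>
        (\<exists>a\<in>A. \<exists>b\<in>B. (a, b) \<in> parcs G) \<and> (\<exists>a\<in>A. \<exists>b\<in>B. (b, a) \<in> parcs G))"

definition num_irreducible_tournaments :: "nat \<Rightarrow> nat" where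
  "num_irreducible_tournaments k =
     card {G :: nat pair_pre_digraph. irreducible_tournament G \<and> pverts G = {1..k}}"

lemma labeled_graphs_iff:
  "G \<in> labeled_graphs n \<longleftrightarrow>
     pverts G = {1..n} \<and> parcs G \<subseteq> {1..n} \<times> {1..n} \<and> sym (parcs G) \<and> irrefl (parcs G)"
  (is "?L \<longleftrightarrow> ?R")
proof
  assume ?L
  then interpret pair_graph G by (simp add: labeled_graphs_def)
  have "pverts G = {1..n}" using \<open>?L\<close> by (simp add: labeled_graphs_def)
  then show ?R
    using pair_sym_arcs pair_no_loops in_arcsD1 in_arcsD2
    unfolding symmetric_def irrefl_def with_proj_simps by fastforce
next
  assume R: ?R
  have "finite (parcs G)" using R finite_subset by blast
  then have "pair_graph G"
    using R by unfold_locales (auto simp: symmetric_def irrefl_def)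
  then show ?L using R by (simp add: labeled_graphs_def)
qed

lemma bij_betw_labeled_graphs:
  "bij_betw (\<lambda>G. {{u, v} |u v. (u, v) \<in> parcs G}) (labeled_graphs n)
     (Pow {e. e \<subseteq> {1..n} \<and> card e = 2})"
  (is "bij_betw ?f _ (Pow ?P)")
proof -
  define g where "g E = \<lparr>pverts = {1..n}, parcs = {(u, v). {u, v} \<in> E}\<rparr>" for E
  have gf: "g (?f G) = G" if "G \<in> labeled_graphs n" for G
  proof -
    have verts: "pverts G = {1..n}" and sym: "sym (parcs G)"
      using that by (simp_all add: labeled_graphs_iff)
    have "{u, v} \<in> ?f G \<longleftrightarrow> (u, v) \<in> parcs G" for u v
      using symD[OF sym] by (auto simp only: mem_Collect_eq doubleton_eq_iff)
    then show ?thesis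
      using verts by (simp add: g_def)
  qed
  have fg: "?f (g E) = E" if "E \<subseteq> ?P" for E
  proof (rule set_eqI)
    fix e
    have "\<exists>u v. e = {u, v}" if "e \<in> E"
      using that \<open>E \<subseteq> ?P\<close> card_2_iff[of e] by auto
    then show "e \<in> ?f (g E) \<longleftrightarrow> e \<in> E"
      by (simp add: g_def) metis
  qed
  have f: "?f G \<subseteq> ?P" if "G \<in> labeled_graphs n" for G
  proof
    fix e assume "e \<in> ?f G"
    then obtain u v where e: "e = {u, v}" and uv: "(u, v) \<in> parcs G" by auto
    then have "u \<in> {1..n}" "v \<in> {1..n}" "u \<noteq> v"
      using that unfolding labeled_graphs_iff irrefl_def by blast+
    then show "e \<in> ?P" using e by simp
  qed
  have g: "g E \<in> labeled_graphs n" if "E \<subseteq> ?P" for E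
  proof -
    have "u \<in> {1..n} \<and> v \<in> {1..n} \<and> u \<noteq> v" if "{u, v} \<in> E" for u v
      using subsetD[OF \<open>E \<subseteq> ?P\<close> that] by (cases "u = v") simp_all
    then show ?thesis
      unfolding labeled_graphs_iff irrefl_def sym_def g_def
      by (auto simp only: pair_pre_digraph.simps insert_commute)
  qed
  show ?thesis
  proof (rule bij_betw_byWitness[where f' = g])
    show "\<forall>G\<in>labeled_graphs n. g (?f G) = G" using gf by (intro ballI)
    show "\<forall>E\<in>Pow ?P. ?f (g E) = E" using fg by (intro ballI) (simp only: Pow_iff)
    show "?f ` labeled_graphs n \<subseteq> Pow ?P"
      by (intro image_subsetI PowI f)
    show "g ` Pow ?P \<subseteq> labeled_graphs n" by (intro image_subsetI g PowD)
  qed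
qed

lemma card_labeled_graphs: "card (labeled_graphs n) = 2 ^ (n choose 2)"
  using bij_betw_same_card[OF bij_betw_labeled_graphs[of n]] n_subsets[of "{1..n}" 2]
  by (simp add: card_Pow)

lemma connected_prob_eq:
  "connected_prob n =
     card {G \<in> labeled_graphs n. Digraph_Component.connected (with_proj G)} / 2 ^ (n choose 2)"
proof -
  have "card (labeled_graphs n) \<noteq> 0" by (simp add: card_labeled_graphs)
  then have "labeled_graphs n \<noteq> {}" "finite (labeled_graphs n)"
    by (auto intro: card_ge_0_finite)
  then show ?thesis
    by (simp add: connected_prob_def measure_pmf_of_set card_labeled_graphs Int_def)
qed

end

theory Submission
  imports Defs "HOL-Real_Asymp.Real_Asymp"
begin

text \<open>
  Write \<open>g n = 2 ^ (n choose 2)\<close>; this is the number of labeled graphs and also the number of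
  labeled tournaments with \<open>n\<close> vertices.  Let \<open>c n\<close> be the number of connected graphs and \<open>i n\<close>
  the number of irreducible tournaments.  The asymptotic expansion of \<open>c n\<close> results from playing
  two facts against each other.

  Graphs: a component that contains all but \<open>j\<close> vertices, with \<open>j < q\<close>, is unique for large \<open>n\<close>.
  A graph without such a component has a union of components of size \<open>k\<close> with
  \<open>q \<le> k \<le> n - q\<close> (\<open>graph_balanced_cut_or_giant\<close>), and so few graphs have such a cut that
  \<open>g n = (\<Sum>j<q. (n choose j) * g j * c (n - j)) + O(n ^ q * g (n - q))\<close>
  (\<open>giant_component_expansion\<close>).

  Tournaments: a nonempty tournament has exactly one sink component, which is irreducible and
  receives all arcs from outside.  Therefore
  \<open>g n = (\<Sum>k=1..n. (n choose k) * i k * g (n - k))\<close> for \<open>n > 0\<close> (\<open>tournament_recurrence\<close>).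
  Equivalently, the exponential generating function of \<open>g\<close> has the inverse \<open>1 - I\<close>, where \<open>I\<close> is
  the exponential generating function of \<open>i\<close>.

  The first fact expresses \<open>g\<close> asymptotically as a convolution of \<open>g\<close> with \<open>c\<close>.  Convolving with
  the inverse of \<open>g\<close> that the second fact provides gives
  \<open>c n = g n - (\<Sum>k=1..r-1. (n choose k) * i k * g (n - k)) + O(n ^ r * g (n - r))\<close>
  (\<open>binomial_convolution_inversion_bigo\<close>, \<open>connected_count_expansion\<close>), and the theorem
  is this formula divided by \<open>g n\<close>.

  Graphs and tournaments are treated together, as sets of arcs in which one of two opposite arcs
  determines the other.  The role of connected components and of the sink component is played by
  irreducible absorbing sets of vertices.
\<close>

section \<open>Graphs and tournaments as arc sets\<close>

text \<open>
  For \<open>b = True\<close> the condition says that \<open>E\<close> is symmetric, so these are the labeled graphs on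
  \<open>V\<close>; for \<open>b = False\<close> it says that exactly one of two opposite arcs is present, so these are
  the labeled tournaments.  In both cases the arc \<open>(u, v)\<close> determines \<open>(v, u)\<close> and can be chosen
  freely for each pair, so the two kinds are counted by the same arguments.
\<close>
definition arc_sets :: "bool \<Rightarrow> 'a set \<Rightarrow> ('a \<times> 'a) set set" where
  "arc_sets b V = {E. E \<subseteq> V \<times> V \<and> irrefl E \<and>
     (\<forall>u\<in>V. \<forall>v\<in>V. u \<noteq> v \<longrightarrow> ((u, v) \<in> E \<longleftrightarrow> ((v, u) \<in> E \<longleftrightarrow> b)))}"

text \<open>
  Strong connectivity expressed by cuts: no proper nonempty part of \<open>S\<close> is without an exit to the
  rest of \<open>S\<close>.  For symmetric \<open>E\<close> it is connectedness, for tournaments it is irreducibility (the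
  arc in the other direction comes from the complementary part).
\<close>
definition irreducible_on :: "'a set \<Rightarrow> ('a \<times> 'a) set \<Rightarrow> bool" where
  "irreducible_on S E \<longleftrightarrow> S \<noteq> {} \<and>
     (\<forall>T\<subseteq>S. T \<noteq> {} \<and> T \<noteq> S \<longrightarrow> (\<exists>u\<in>T. \<exists>v\<in>S - T. (u, v) \<in> E))"

text \<open>
  For graphs these are the unions of connected components, for tournaments the unions of terminal
  segments in the linear order of the strong components.
\<close>
definition absorbing :: "'a set \<Rightarrow> ('a \<times> 'a) set \<Rightarrow> 'a set \<Rightarrow> bool" where
  "absorbing V E S \<longleftrightarrow> S \<subseteq> V \<and> (\<forall>u\<in>S. \<forall>v\<in>V - S. (u, v) \<notin> E)"

definition num_irreducible :: "bool \<Rightarrow> nat \<Rightarrow> nat" where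
  "num_irreducible b n = card {E \<in> arc_sets b {1..n}. irreducible_on {1..n} E}"

lemma arc_setsI:
  assumes "\<And>u v. (u, v) \<in> E \<Longrightarrow> u \<in> V \<and> v \<in> V \<and> u \<noteq> v"
    and "\<And>u v. u \<in> V \<Longrightarrow> v \<in> V \<Longrightarrow> u \<noteq> v \<Longrightarrow> (u, v) \<in> E \<longleftrightarrow> ((v, u) \<in> E \<longleftrightarrow> b)"
  shows "E \<in> arc_sets b V"
  unfolding arc_sets_def irrefl_def
proof (intro CollectI conjI ballI impI allI)
  show "E \<subseteq> V \<times> V" using assms(1) by (intro subrelI SigmaI) blast+
  show "(a, a) \<notin> E" for a using assms(1)[of a a] by blast
  fix u v assume "u \<in> V" "v \<in> V" "u \<noteq> v"
  then show "(u, v) \<in> E \<longleftrightarrow> ((v, u) \<in> E \<longleftrightarrow> b)" by (rule assms(2))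
qed

lemma arc_setsD:
  assumes "E \<in> arc_sets b V"
  shows "(u, v) \<in> E \<Longrightarrow> u \<in> V \<and> v \<in> V \<and> u \<noteq> v"
    and "u \<in> V \<Longrightarrow> v \<in> V \<Longrightarrow> u \<noteq> v \<Longrightarrow> (u, v) \<in> E \<longleftrightarrow> ((v, u) \<in> E \<longleftrightarrow> b)"
proof -
  show "(u, v) \<in> E \<Longrightarrow> u \<in> V \<and> v \<in> V \<and> u \<noteq> v"
    using assms unfolding arc_sets_def irrefl_def by blast
  have "\<forall>u\<in>V. \<forall>v\<in>V. u \<noteq> v \<longrightarrow> ((u, v) \<in> E \<longleftrightarrow> ((v, u) \<in> E \<longleftrightarrow> b))"
    using assms unfolding arc_sets_def mem_Collect_eq by (elim conjE)
  then show "u \<in> V \<Longrightarrow> v \<in> V \<Longrightarrow> u \<noteq> v \<Longrightarrow> (u, v) \<in> E \<longleftrightarrow> ((v, u) \<in> E \<longleftrightarrow> b)"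
    by (auto simp only:)
qed

lemma arc_sets_restrict:
  assumes "E \<in> arc_sets b V" "S \<subseteq> V"
  shows "E \<inter> S \<times> S \<in> arc_sets b S"
proof (rule arc_setsI)
  fix u v assume "u \<in> S" "v \<in> S" "u \<noteq> v"
  then show "(u, v) \<in> E \<inter> S \<times> S \<longleftrightarrow> ((v, u) \<in> E \<inter> S \<times> S \<longleftrightarrow> b)"
    using arc_setsD(2)[OF assms(1), of u v] assms(2) by auto
qed (use arc_setsD(1)[OF assms(1)] in auto)

lemma finite_arc_sets: "finite V \<Longrightarrow> finite (arc_sets b V)"
  by (rule finite_subset[of _ "Pow (V \<times> V)"]) (auto simp: arc_sets_def)

lemma card_arc_sets:
  assumes "finite V"
  shows "card (arc_sets b V) = 2 ^ (card V choose 2)"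
  using assms
proof (induction V rule: finite_induct)
  case empty
  have "arc_sets b ({} :: 'a set) = {{}}"
    by (auto simp: arc_sets_def irrefl_def)
  then show ?case by (simp add: binomial_eq_0)
next
  case (insert x V)
  let ?f = "\<lambda>E. (E \<inter> V \<times> V, {v \<in> V. (x, v) \<in> E})"
  let ?g = "\<lambda>(E, N). E \<union> {x} \<times> N \<union> (if b then N else V - N) \<times> {x}"
  have "bij_betw ?f (arc_sets b (insert x V)) (arc_sets b V \<times> Pow V)"
  proof (rule bij_betw_byWitness[where f' = ?g])
    show "\<forall>E\<in>arc_sets b (insert x V). ?g (?f E) = E"
    proof
      fix E assume E: "E \<in> arc_sets b (insert x V)"
      have "(u, v) \<in> ?g (?f E) \<longleftrightarrow> (u, v) \<in> E" for u v
        using arc_setsD(1)[OF E, of u v] arc_setsD(2)[OF E, of u v] insert.hyps(2)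
        by auto
      then show "?g (?f E) = E" by (intro set_eqI) (simp only: split_paired_all)
    qed
    show "\<forall>p\<in>arc_sets b V \<times> Pow V. ?f (?g p) = p"
    proof
      fix p assume "p \<in> arc_sets b V \<times> Pow V"
      then obtain E N where p: "p = (E, N)" and E: "E \<in> arc_sets b V" and N: "N \<subseteq> V" by auto
      show "?f (?g p) = p"
        unfolding p using arc_setsD(1)[OF E] N insert.hyps(2) by (cases b) auto
    qed
    show "?f ` arc_sets b (insert x V) \<subseteq> arc_sets b V \<times> Pow V"
    proof (intro image_subsetI SigmaI)
      fix E assume E: "E \<in> arc_sets b (insert x V)"
      show "E \<inter> V \<times> V \<in> arc_sets b V"
        using arc_sets_restrict[OF E, of V] by auto
    qed auto
    show "?g ` (arc_sets b V \<times> Pow V) \<subseteq> arc_sets b (insert x V)"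
    proof (clarify)
      fix E N assume E: "E \<in> arc_sets b V" and N: "N \<subseteq> V"
      show "E \<union> {x} \<times> N \<union> (if b then N else V - N) \<times> {x} \<in> arc_sets b (insert x V)"
      proof (rule arc_setsI)
        fix u v assume "(u, v) \<in> E \<union> {x} \<times> N \<union> (if b then N else V - N) \<times> {x}"
        then show "u \<in> insert x V \<and> v \<in> insert x V \<and> u \<noteq> v"
          using arc_setsD(1)[OF E, of u v] N insert.hyps(2) by (auto split: if_splits)
      next
        fix u v assume uv: "u \<in> insert x V" "v \<in> insert x V" "u \<noteq> v"
        show "(u, v) \<in> E \<union> {x} \<times> N \<union> (if b then N else V - N) \<times> {x} \<longleftrightarrow>
          ((v, u) \<in> E \<union> {x} \<times> N \<union> (if b then N else V - N) \<times> {x} \<longleftrightarrow> b)"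
        proof (cases "u = x \<or> v = x")
          case True
          then have "(u, v) \<notin> E" "(v, u) \<notin> E"
            using arc_setsD(1)[OF E] insert.hyps(2) by blast+
          then show ?thesis using True uv N insert.hyps(2) by auto
        next
          case False
          then show ?thesis using uv arc_setsD(2)[OF E, of u v] by simp
        qed
      qed
    qed
  qed
  then have "card (arc_sets b (insert x V)) = card (arc_sets b V \<times> Pow V)"
    by (rule bij_betw_same_card)
  also have "\<dots> = 2 ^ (card V choose 2) * 2 ^ card V"
    using insert by (simp add: card_cartesian_product card_Pow)
  also have "\<dots> = 2 ^ (card (insert x V) choose 2)"
    using insert.hyps by (simp add: numeral_2_eq_2 power_add)
  finally show ?case .
qed

text \<open>Relabeling the vertices carries irreducible arc sets to irreducible arc sets.\<close>
lemma card_irreducible_le: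
  assumes "bij_betw f V W" "finite W"
  shows "card {E \<in> arc_sets b V. irreducible_on V E} \<le> card {E \<in> arc_sets b W. irreducible_on W E}"
proof (rule card_inj_on_le[where f = "image (map_prod f f)"])
  have inj: "inj_on f V" and W: "W = f ` V"
    using assms(1) by (auto simp: bij_betw_def)
  have "inj_on (image (map_prod f f)) (Pow (V \<times> V))"
    by (intro inj_on_image_Pow map_prod_inj_on inj)
  then show "inj_on (image (map_prod f f)) {E \<in> arc_sets b V. irreducible_on V E}"
    by (rule inj_on_subset) (auto dest: arc_setsD(1))
  show "finite {E \<in> arc_sets b W. irreducible_on W E}"
    using finite_arc_sets[OF assms(2)] by simp
  show "image (map_prod f f) ` {E \<in> arc_sets b V. irreducible_on V E}
      \<subseteq> {E \<in> arc_sets b W. irreducible_on W E}"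
  proof (intro image_subsetI, clarify, rule conjI)
    fix E assume E: "E \<in> arc_sets b V" and irr: "irreducible_on V E"
    have mem: "(f u, f v) \<in> map_prod f f ` E \<longleftrightarrow> (u, v) \<in> E" if "u \<in> V" "v \<in> V" for u v
    proof
      assume "(f u, f v) \<in> map_prod f f ` E"
      then obtain u' v' where "(u', v') \<in> E" "f u' = f u" "f v' = f v" by auto
      then show "(u, v) \<in> E" using that arc_setsD(1)[OF E, of u' v'] inj_onD[OF inj] by metis
    qed force
    show "map_prod f f ` E \<in> arc_sets b W"
    proof (rule arc_setsI)
      fix u v assume "(u, v) \<in> map_prod f f ` E"
      then show "u \<in> W \<and> v \<in> W \<and> u \<noteq> v"
        using arc_setsD(1)[OF E] inj_onD[OF inj] unfolding W by auto
    next
      fix u v assume "u \<in> W" "v \<in> W" "u \<noteq> v"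
      then obtain u' v' where uv: "u = f u'" "v = f v'" "u' \<in> V" "v' \<in> V" "u' \<noteq> v'"
        unfolding W by blast
      then show "(u, v) \<in> map_prod f f ` E \<longleftrightarrow> ((v, u) \<in> map_prod f f ` E \<longleftrightarrow> b)"
        using arc_setsD(2)[OF E uv(3-5)] by (simp only: mem)
    qed
    show "irreducible_on W (map_prod f f ` E)"
      unfolding irreducible_on_def
    proof (intro conjI allI impI)
      show "W \<noteq> {}" using irr by (auto simp: W irreducible_on_def)
    next
      fix T assume T: "T \<subseteq> W" "T \<noteq> {} \<and> T \<noteq> W"
      let ?T = "{u \<in> V. f u \<in> T}"
      have "?T \<subseteq> V" "?T \<noteq> {}" "?T \<noteq> V" using T by (auto simp: W)
      then obtain u v where "u \<in> ?T" "v \<in> V - ?T" "(u, v) \<in> E"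
        using irr unfolding irreducible_on_def by meson
      then show "\<exists>u\<in>T. \<exists>v\<in>W - T. (u, v) \<in> map_prod f f ` E"
        by (intro bexI[of _ "f u"] bexI[of _ "f v"]) (auto simp: W)
    qed
  qed
qed

lemma card_irreducible_arc_sets:
  assumes "finite V"
  shows "card {E \<in> arc_sets b V. irreducible_on V E} = num_irreducible b (card V)"
proof -
  obtain f where f: "bij_betw f V {1..card V}"
    using finite_same_card_bij[OF assms, of "{1..card V}"] by auto
  show ?thesis
    unfolding num_irreducible_def
    using card_irreducible_le[OF f] card_irreducible_le[OF bij_betw_inv_into[OF f] assms]
    by (intro antisym) auto
qed

lemma irreducible_on_restrict: "irreducible_on S (E \<inter> S \<times> S) \<longleftrightarrow> irreducible_on S E"
  unfolding irreducible_on_def by blast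

section \<open>Counting by absorbing subsets\<close>

text \<open>
  If \<open>S\<close> is absorbing, every arc variable between \<open>S\<close> and \<open>V - S\<close> is forced: there is no arc at
  all for graphs, and all arcs lead into \<open>S\<close> for tournaments.  Hence the arc set is determined by
  its restrictions to \<open>S\<close> and to \<open>V - S\<close>, which are independent.
\<close>
lemma card_absorbing_split:
  assumes "finite V" "S \<subseteq> V"
  shows "card {E \<in> arc_sets b V. absorbing V E S \<and> P (E \<inter> S \<times> S)} =
    card {E \<in> arc_sets b S. P E} * card (arc_sets b (V - S))"
proof -
  let ?R = "V - S"
  let ?X = "if b then {} else ?R \<times> S"
  let ?f = "\<lambda>E. (E \<inter> S \<times> S, E \<inter> ?R \<times> ?R)"
  let ?g = "\<lambda>(E1, E2). E1 \<union> E2 \<union> ?X"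
  let ?A = "{E \<in> arc_sets b V. absorbing V E S \<and> P (E \<inter> S \<times> S)}"
  let ?B = "{E \<in> arc_sets b S. P E} \<times> arc_sets b ?R"
  have fg: "?f (?g (E1, E2)) = (E1, E2)" if "E1 \<in> arc_sets b S" "E2 \<in> arc_sets b ?R" for E1 E2
    using arc_setsD(1)[OF that(1)] arc_setsD(1)[OF that(2)] by auto
  have "bij_betw ?f ?A ?B"
  proof (rule bij_betw_byWitness[where f' = ?g])
    show "\<forall>E\<in>?A. ?g (?f E) = E"
    proof
      fix E assume "E \<in> ?A"
      then have E: "E \<in> arc_sets b V" and S: "absorbing V E S" by auto
      have "(u, v) \<in> ?g (?f E) \<longleftrightarrow> (u, v) \<in> E" for u v
        using arc_setsD(1)[OF E, of u v] arc_setsD(2)[OF E, of u v] S \<open>S \<subseteq> V\<close>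
        unfolding absorbing_def by auto
      then show "?g (?f E) = E" by (intro set_eqI) (simp only: split_paired_all)
    qed
    show "\<forall>p\<in>?B. ?f (?g p) = p" using fg by blast
    show "?f ` ?A \<subseteq> ?B"
    proof (intro image_subsetI SigmaI)
      fix E assume "E \<in> ?A"
      then have E: "E \<in> arc_sets b V" and P: "P (E \<inter> S \<times> S)" by auto
      show "E \<inter> S \<times> S \<in> {E \<in> arc_sets b S. P E}"
        using arc_sets_restrict[OF E \<open>S \<subseteq> V\<close>] P by simp
      show "E \<inter> ?R \<times> ?R \<in> arc_sets b ?R"
        using arc_sets_restrict[OF E, of ?R] by auto
    qed
    show "?g ` ?B \<subseteq> ?A"
    proof (clarify, intro conjI)
      fix E1 E2 assume E1: "E1 \<in> arc_sets b S" and P: "P E1" and E2: "E2 \<in> arc_sets b ?R"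
      show "E1 \<union> E2 \<union> ?X \<in> arc_sets b V"
      proof (rule arc_setsI)
        fix u v assume "(u, v) \<in> E1 \<union> E2 \<union> ?X"
        then show "u \<in> V \<and> v \<in> V \<and> u \<noteq> v"
          using arc_setsD(1)[OF E1, of u v] arc_setsD(1)[OF E2, of u v] \<open>S \<subseteq> V\<close>
          by (auto split: if_splits)
      next
        fix u v assume uv: "u \<in> V" "v \<in> V" "u \<noteq> v"
        show "(u, v) \<in> E1 \<union> E2 \<union> ?X \<longleftrightarrow> ((v, u) \<in> E1 \<union> E2 \<union> ?X \<longleftrightarrow> b)"
        proof -
          have E1': "(u, v) \<notin> E1 \<and> (v, u) \<notin> E1" if "\<not> (u \<in> S \<and> v \<in> S)"
            using arc_setsD(1)[OF E1] that by blast
          have E2': "(u, v) \<notin> E2 \<and> (v, u) \<notin> E2" if "u \<in> S \<or> v \<in> S"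
            using arc_setsD(1)[OF E2] that by blast
          consider "u \<in> S" "v \<in> S" | "u \<notin> S" "v \<notin> S" | "u \<in> S \<longleftrightarrow> v \<notin> S" by blast
          then show ?thesis
          proof cases
            case 1
            then show ?thesis using E2' arc_setsD(2)[OF E1, of u v] uv by simp
          next
            case 2
            then show ?thesis using E1' arc_setsD(2)[OF E2, of u v] uv by simp
          next
            case 3
            then show ?thesis using E1' E2' uv by auto
          qed
        qed
      qed
      show "absorbing V (E1 \<union> E2 \<union> ?X) S"
        using arc_setsD(1)[OF E1] arc_setsD(1)[OF E2] \<open>S \<subseteq> V\<close>
        unfolding absorbing_def by auto
      show "P ((E1 \<union> E2 \<union> ?X) \<inter> S \<times> S)"
        using fg[OF E1 E2] P by simp
    qed
  qed
  then have "card ?A = card ?B" by (rule bij_betw_same_card)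
  then show ?thesis by (simp add: card_cartesian_product)
qed

lemma card_absorbing_irreducible:
  assumes "finite V" "S \<subseteq> V"
  shows "card {E \<in> arc_sets b V. absorbing V E S \<and> irreducible_on S E} =
    num_irreducible b (card S) * 2 ^ (card V - card S choose 2)"
  using card_absorbing_split[OF assms, of b "irreducible_on S"] assms
  by (simp add: irreducible_on_restrict card_irreducible_arc_sets card_arc_sets card_Diff_subset finite_subset)

lemma card_absorbing:
  assumes "finite V" "S \<subseteq> V"
  shows "card {E \<in> arc_sets b V. absorbing V E S} =
    2 ^ (card S choose 2) * 2 ^ (card V - card S choose 2)"
  using card_absorbing_split[OF assms, of b "\<lambda>_. True"] assms
  by (simp add: card_arc_sets card_Diff_subset finite_subset)

lemma sum_subsets_by_card:
  fixes h :: "nat \<Rightarrow> nat"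
  assumes "finite V" "finite K"
  shows "(\<Sum>S | S \<subseteq> V \<and> card S \<in> K. h (card S)) = (\<Sum>k\<in>K. (card V choose k) * h k)"
proof -
  let ?A = "{S. S \<subseteq> V \<and> card S \<in> K}"
  have "(\<Sum>S\<in>?A. h (card S)) = (\<Sum>k\<in>K. \<Sum>S\<in>{S \<in> ?A. card S = k}. h (card S))"
    using assms by (intro sum.group[symmetric]) auto
  also have "\<dots> = (\<Sum>k\<in>K. (card V choose k) * h k)"
  proof (rule sum.cong)
    fix k assume "k \<in> K"
    then have "{S \<in> ?A. card S = k} = {S. S \<subseteq> V \<and> card S = k}" by auto
    then show "(\<Sum>S\<in>{S \<in> ?A. card S = k}. h (card S)) = (card V choose k) * h k"
      using n_subsets[OF assms(1), of k] by simp
  qed simp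
  finally show ?thesis .
qed

section \<open>Minimal absorbing subsets\<close>

text \<open>
  The intersection of two absorbing sets is absorbing, so it cannot be a proper nonempty part of an
  irreducible one.
\<close>
lemma absorbing_irreducible_unique:
  assumes "absorbing V E S" "irreducible_on S E" "absorbing V E S'" "irreducible_on S' E"
    and "S \<inter> S' \<noteq> {}"
  shows "S = S'"
proof -
  have "S \<subseteq> S'" if abs: "absorbing V E S" "absorbing V E S'" and irr: "irreducible_on S E"
    and ne: "S \<inter> S' \<noteq> {}" for S S'
  proof (rule ccontr)
    assume "\<not> S \<subseteq> S'"
    then obtain u v where "u \<in> S \<inter> S'" "v \<in> S - S \<inter> S'" "(u, v) \<in> E"
      using irr ne unfolding irreducible_on_def by (metis inf.absorb_iff1 inf_le1)
    then show False using abs unfolding absorbing_def by blast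
  qed
  then show ?thesis using assms by (metis inf_commute subset_antisym)
qed

lemma not_irreducible_onE:
  assumes "\<not> irreducible_on S E" "S \<noteq> {}" "absorbing V E S"
  obtains T where "T \<subset> S" "T \<noteq> {}" "absorbing V E T"
proof -
  obtain T where T: "T \<subseteq> S" "T \<noteq> {}" "T \<noteq> S" "\<forall>u\<in>T. \<forall>v\<in>S - T. (u, v) \<notin> E"
    using assms(1,2) unfolding irreducible_on_def by blast
  then have "absorbing V E T" using assms(3) unfolding absorbing_def by blast
  then show thesis using that T by blast
qed

text \<open>
  The threshold \<open>q\<close> is what makes this useful for graphs: with \<open>q = 1\<close> the minimal set is a
  component, while a larger \<open>q\<close> glues small components together until their size reaches \<open>q\<close>.
\<close>
lemma ex_minimal_absorbing:
  assumes "finite V" "q \<le> card V"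
  obtains S where "absorbing V E S" "q \<le> card S"
    "\<And>T. T \<subset> S \<Longrightarrow> absorbing V E T \<Longrightarrow> card T < q"
proof -
  have "absorbing V E V \<and> q \<le> card V" using assms(2) by (simp add: absorbing_def)
  from ex_has_least_nat[of "\<lambda>S. absorbing V E S \<and> q \<le> card S", OF this, of card]
  obtain S where S: "absorbing V E S" "q \<le> card S"
    "\<And>T. absorbing V E T \<Longrightarrow> q \<le> card T \<Longrightarrow> card S \<le> card T" by blast
  have "finite S" using S(1) assms(1) unfolding absorbing_def by (blast intro: finite_subset)
  then have "card T < q" if "T \<subset> S" "absorbing V E T" for T
    using S(3)[OF that(2)] psubset_card_mono[OF _ that(1)] by linarith
  then show thesis using that S by blast
qed

text \<open>
  Two disjoint nonempty absorbing sets cannot exist in a tournament, because some arc joins them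
  and leaves one of the two.
\<close>
lemma tournament_ex1_sink_component:
  assumes "finite V" "V \<noteq> {}" "E \<in> arc_sets False V"
  shows "\<exists>!S. absorbing V E S \<and> irreducible_on S E"
proof (rule ex_ex1I)
  have "1 \<le> card V" using assms by (simp add: Suc_le_eq card_gt_0_iff)
  then obtain S where S: "absorbing V E S" "1 \<le> card S"
    "\<And>T. T \<subset> S \<Longrightarrow> absorbing V E T \<Longrightarrow> card T < 1"
    using ex_minimal_absorbing[OF assms(1)] by blast
  have fin: "finite S" using S(2) by (simp add: card_ge_0_finite)
  have "S \<noteq> {}" using S(2) by auto
  have "irreducible_on S E"
  proof (rule ccontr)
    assume "\<not> irreducible_on S E"
    then obtain T where T: "T \<subset> S" "T \<noteq> {}" "absorbing V E T"
      using \<open>S \<noteq> {}\<close> S(1) by (rule not_irreducible_onE)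
    then have "finite T" using fin by (auto intro: finite_subset)
    then show False using S(3)[OF T(1,3)] T(2) by simp
  qed
  then show "\<exists>S. absorbing V E S \<and> irreducible_on S E" using S(1) by blast
next
  fix S S' assume S: "absorbing V E S \<and> irreducible_on S E" and S': "absorbing V E S' \<and> irreducible_on S' E"
  have "S \<inter> S' \<noteq> {}"
  proof
    assume disj: "S \<inter> S' = {}"
    obtain u v where "u \<in> S" "v \<in> S'"
      using S S' unfolding irreducible_on_def by blast
    then show False
      using disj S S' arc_setsD(2)[OF assms(3), of u v] unfolding absorbing_def by blast
  qed
  then show "S = S'" using absorbing_irreducible_unique S S' by blast
qed

text \<open>
  Split the tournaments on \<open>n\<close> vertices according to their sink component.  In terms of
  exponential generating functions, where \<open>G\<close> counts tournaments and \<open>I\<close> irreducible ones, this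
  is \<open>G = 1 + I * G\<close>.
\<close>
lemma tournament_recurrence:
  assumes "n \<ge> 1"
  shows "(\<Sum>k=1..n. (n choose k) * (num_irreducible False k * 2 ^ (n - k choose 2))) =
    2 ^ (n choose 2)"
proof -
  let ?V = "{1..n}"
  let ?R = "\<lambda>E S. absorbing ?V E S \<and> irreducible_on S E"
  let ?S = "{S. S \<subseteq> ?V \<and> card S \<in> {1..n}}"
  have "(\<Sum>k=1..n. (n choose k) * (num_irreducible False k * 2 ^ (n - k choose 2))) =
      (\<Sum>S\<in>?S. num_irreducible False (card S) * 2 ^ (n - card S choose 2))"
    using sum_subsets_by_card[of ?V "{1..n}" "\<lambda>k. num_irreducible False k * 2 ^ (n - k choose 2)"]
    by simp
  also have "\<dots> = (\<Sum>E\<in>arc_sets False ?V. card {S \<in> ?S. ?R E S})"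
  proof (rule sum_multicount_gen[symmetric])
    show "\<forall>S\<in>?S. card {E \<in> arc_sets False ?V. ?R E S} =
        num_irreducible False (card S) * 2 ^ (n - card S choose 2)"
      using card_absorbing_irreducible[of ?V _ False] by simp
  qed (simp_all add: finite_arc_sets)
  also have "\<dots> = (\<Sum>E\<in>arc_sets False ?V. 1)"
  proof (rule sum.cong)
    fix E assume "E \<in> arc_sets False ?V"
    then obtain S where S: "?R E S" "\<And>S'. ?R E S' \<Longrightarrow> S' = S"
      using tournament_ex1_sink_component[of ?V E] assms by auto
    have "S \<subseteq> ?V" "S \<noteq> {}" using S(1) by (auto simp: absorbing_def irreducible_on_def)
    then have "card S \<in> {1..n}"
      using card_mono[of ?V S] by (simp add: Suc_le_eq card_gt_0_iff finite_subset)
    then have "{S \<in> ?S. ?R E S} = {S}" using S \<open>S \<subseteq> ?V\<close> by blast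
    then show "card {S \<in> ?S. ?R E S} = 1" by simp
  qed simp
  also have "\<dots> = 2 ^ (n choose 2)" by (simp add: card_arc_sets)
  finally show ?thesis .
qed

text \<open>
  Take a smallest absorbing set \<open>S\<close> with at least \<open>q\<close> vertices and suppose that it has more than
  \<open>card V - q\<close>, hence more than \<open>2 * q\<close>, vertices.  If \<open>S\<close> were disconnected, it would split
  into two absorbing parts, and the larger one would have at least \<open>q\<close> vertices, against
  minimality.
\<close>
lemma graph_balanced_cut_or_giant:
  assumes "finite V" "1 \<le> q" "3 * q \<le> card V" "E \<in> arc_sets True V"
  shows "(\<exists>S. absorbing V E S \<and> card S \<in> {q..card V - q}) \<or>
    (\<exists>S. absorbing V E S \<and> irreducible_on S E \<and> card S \<in> {card V - q<..card V})"
proof -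
  obtain S where S: "absorbing V E S" "q \<le> card S"
    "\<And>T. T \<subset> S \<Longrightarrow> absorbing V E T \<Longrightarrow> card T < q"
    using ex_minimal_absorbing[OF assms(1), of q] assms(3) by auto
  have sub: "S \<subseteq> V" using S(1) by (simp add: absorbing_def)
  then have fin: "finite S" and le: "card S \<le> card V"
    using assms(1) by (auto intro: finite_subset card_mono)
  show ?thesis
  proof (cases "card S \<le> card V - q")
    case True
    then show ?thesis using S by auto
  next
    case False
    have "irreducible_on S E"
    proof (rule ccontr)
      assume "\<not> irreducible_on S E"
      moreover have "S \<noteq> {}" using S(2) assms(2) by auto
      ultimately obtain T where T: "T \<subset> S" "T \<noteq> {}" "absorbing V E T"
        using S(1) by (rule not_irreducible_onE)
      have "absorbing V E (S - T)"
        unfolding absorbing_def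
      proof (intro conjI ballI)
        show "S - T \<subseteq> V" using sub by blast
        fix u v assume uv: "u \<in> S - T" "v \<in> V - (S - T)"
        show "(u, v) \<notin> E"
        proof (cases "v \<in> T")
          case True
          then have "(v, u) \<notin> E" using T(3) uv(1) sub unfolding absorbing_def by blast
          then show ?thesis
            using arc_setsD(2)[OF assms(4), of u v] uv True sub by blast
        next
          case False
          then show ?thesis using S(1) uv unfolding absorbing_def by blast
        qed
      qed
      then have "card (S - T) < q" using S(3)[of "S - T"] T by blast
      moreover have "card T < q" using S(3) T by blast
      moreover have "card S = card T + card (S - T)"
        using T(1) fin by (metis card_Un_disjoint Diff_disjoint finite_Diff finite_subset
            psubsetE Un_Diff_cancel Un_absorb1)
      ultimately show False using False assms(3) by linarith
    qed
    then show ?thesis using S(1) le False by auto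
  qed
qed

text \<open>
  The sum \<open>giant\<close> counts pairs of a graph and a component with more than \<open>n - q\<close> vertices.  A graph
  has at most one such component, since two of them would have more than \<open>n\<close> vertices together;
  if it has none, it has a union of components whose size lies between \<open>q\<close> and \<open>n - q\<close>.
\<close>
lemma graph_giant_component_count:
  assumes "1 \<le> q" "3 * q \<le> n"
  defines "giant \<equiv> (\<Sum>j<q. (n choose j) * (2 ^ (j choose 2) * num_irreducible True (n - j)))"
  shows "giant \<le> 2 ^ (n choose 2)"
    and "2 ^ (n choose 2) \<le> giant +
      (\<Sum>k=q..n - q. (n choose k) * (2 ^ (k choose 2) * 2 ^ (n - k choose 2)))"
proof -
  let ?V = "{1..n}"
  let ?A = "arc_sets True ?V"
  let ?R = "\<lambda>E S. absorbing ?V E S \<and> irreducible_on S E"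
  let ?S = "{S. S \<subseteq> ?V \<and> card S \<in> {n - q<..n}}"
  let ?C = "{S. S \<subseteq> ?V \<and> card S \<in> {q..n - q}}"
  have "giant = (\<Sum>k\<in>{n - q<..n}. (n choose k) * (num_irreducible True k * 2 ^ (n - k choose 2)))"
    unfolding giant_def
    by (rule sum.reindex_bij_witness[where i = "\<lambda>k. n - k" and j = "\<lambda>j. n - j"])
      (use assms in \<open>auto simp: binomial_symmetric[symmetric]\<close>)
  also have "\<dots> = (\<Sum>S\<in>?S. num_irreducible True (card S) * 2 ^ (n - card S choose 2))"
    using sum_subsets_by_card[of ?V "{n - q<..n}" "\<lambda>k. num_irreducible True k * 2 ^ (n - k choose 2)"]
    by simp
  also have "\<dots> = (\<Sum>E\<in>?A. card {S \<in> ?S. ?R E S})"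
  proof (rule sum_multicount_gen[symmetric])
    show "\<forall>S\<in>?S. card {E \<in> ?A. ?R E S} =
        num_irreducible True (card S) * 2 ^ (n - card S choose 2)"
      using card_absorbing_irreducible[of ?V _ True] by simp
  qed (simp_all add: finite_arc_sets)
  finally have giant: "giant = (\<Sum>E\<in>?A. card {S \<in> ?S. ?R E S})" .
  have "(\<Sum>k=q..n - q. (n choose k) * (2 ^ (k choose 2) * 2 ^ (n - k choose 2))) =
      (\<Sum>S\<in>?C. 2 ^ (card S choose 2) * 2 ^ (n - card S choose 2))"
    using sum_subsets_by_card[of ?V "{q..n - q}" "\<lambda>k. 2 ^ (k choose 2) * 2 ^ (n - k choose 2)"]
    by simp
  also have "\<dots> = (\<Sum>E\<in>?A. card {S \<in> ?C. absorbing ?V E S})"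
  proof (rule sum_multicount_gen[symmetric])
    show "\<forall>S\<in>?C. card {E \<in> ?A. absorbing ?V E S} = 2 ^ (card S choose 2) * 2 ^ (n - card S choose 2)"
      using card_absorbing[of ?V _ True] by simp
  qed (simp_all add: finite_arc_sets)
  finally have cuts: "(\<Sum>k=q..n - q. (n choose k) * (2 ^ (k choose 2) * 2 ^ (n - k choose 2))) =
      (\<Sum>E\<in>?A. card {S \<in> ?C. absorbing ?V E S})" .
  have one: "(2::nat) ^ (n choose 2) = (\<Sum>E\<in>?A. 1)" by (simp add: card_arc_sets)
  have "card {S \<in> ?S. ?R E S} \<le> 1" for E
  proof -
    have "S = S'" if S: "S \<in> ?S" "?R E S" and S': "S' \<in> ?S" "?R E S'" for S S'
    proof -
      have "S \<inter> S' \<noteq> {}"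
      proof
        assume "S \<inter> S' = {}"
        then have "card (S \<union> S') = card S + card S'"
          using S(1) S'(1) by (intro card_Un_disjoint) (auto intro: finite_subset)
        moreover have "card (S \<union> S') \<le> card ?V" using S(1) S'(1) by (intro card_mono) auto
        ultimately show False using S(1) S'(1) assms(2) by auto
      qed
      then show ?thesis using absorbing_irreducible_unique S(2) S'(2) by blast
    qed
    then have "\<forall>S\<in>{S \<in> ?S. ?R E S}. \<forall>S'\<in>{S \<in> ?S. ?R E S}. S = S'" by blast
    moreover have "finite {S \<in> ?S. ?R E S}" by simp
    ultimately show ?thesis by (simp only: card_le_Suc0_iff_eq One_nat_def)
  qed
  then show "giant \<le> 2 ^ (n choose 2)"
    unfolding giant one by (intro sum_mono)
  have "1 \<le> card {S \<in> ?S. ?R E S} + card {S \<in> ?C. absorbing ?V E S}" if "E \<in> ?A" for E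
  proof -
    have "{S \<in> ?S. ?R E S} \<noteq> {} \<or> {S \<in> ?C. absorbing ?V E S} \<noteq> {}"
      using graph_balanced_cut_or_giant[of ?V q E] assms that
      by (auto simp: absorbing_def)
    then have "0 < card {S \<in> ?S. ?R E S} \<or> 0 < card {S \<in> ?C. absorbing ?V E S}"
      by (simp only: card_gt_0_iff) simp
    then show ?thesis by linarith
  qed
  then show "2 ^ (n choose 2) \<le> giant +
      (\<Sum>k=q..n - q. (n choose k) * (2 ^ (k choose 2) * 2 ^ (n - k choose 2)))"
    unfolding giant one cuts sum.distrib[symmetric] by (intro sum_mono)
qed

section \<open>Balanced cuts are rare\<close>

lemma choose_two_add: "(a + b) choose 2 = (a choose 2) + (b choose 2) + a * b"
  by (induction b) (simp_all add: numeral_2_eq_2)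

text \<open>
  Write \<open>d = m - q\<close>.  Moving \<open>d\<close> vertices across the cut changes the binomial factor by at most
  \<open>n ^ d\<close>, but adds \<open>d * (n - m - q)\<close> potential edges between the two sides.  As \<open>n - m\<close> is at
  least \<open>n / 2\<close>, for large \<open>n\<close> the edges win by more than a factor \<open>2 ^ d\<close>.
\<close>
lemma balanced_cut_term_le:
  assumes "q \<le> m" "2 * m \<le> n" "(2 * n)\<^sup>2 * 4 ^ q \<le> 2 ^ n"
  shows "(n choose m) * (2 ^ (m choose 2) * 2 ^ (n - m choose 2)) * 2 ^ (m - q) \<le>
    n ^ q * (2 ^ (q choose 2) * 2 ^ (n - q choose 2))"
proof -
  obtain d where m: "m = q + d" using assms(1) le_Suc_ex by blast
  define l where "l = n - m"
  have n: "n = m + l" using assms(2) by (simp add: l_def)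
  have "(2 * n * 2 ^ q)\<^sup>2 \<le> (2 ^ l)\<^sup>2"
  proof -
    have "(2 * n * 2 ^ q)\<^sup>2 = (2 * n)\<^sup>2 * 4 ^ q"
      by (simp add: power2_eq_square flip: power_mult_distrib)
    also have "\<dots> \<le> 2 ^ n" by (rule assms(3))
    also have "\<dots> \<le> 2 ^ (l * 2)" using assms(2) by (intro power_increasing) (auto simp: l_def)
    finally show ?thesis by (simp add: power_mult)
  qed
  then have le: "2 * n * 2 ^ q \<le> 2 ^ l" by (rule power2_le_imp_le) simp
  \<comment> \<open>Of \<open>n ^ m * 2 ^ d\<close> only \<open>n ^ q\<close> survives: the factor \<open>(2 * n) ^ d\<close>, together with the
    \<open>2 ^ (q * d)\<close> contained in \<open>2 ^ (m choose 2)\<close>, is bounded by \<open>le\<close>.\<close>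
  have "(n choose m) * (2 ^ (m choose 2) * 2 ^ (l choose 2)) * 2 ^ d \<le>
      n ^ m * (2 ^ (m choose 2) * 2 ^ (l choose 2)) * 2 ^ d"
    using binomial_le_pow[of m n] n by (intro mult_right_mono) auto
  also have "\<dots> = n ^ q * 2 ^ (q choose 2) * 2 ^ (l choose 2) * 2 ^ (d choose 2) * (2 * n * 2 ^ q) ^ d"
    by (simp add: m choose_two_add power_add power_mult_distrib mult_ac flip: power_mult)
  also have "\<dots> \<le> n ^ q * 2 ^ (q choose 2) * 2 ^ (l choose 2) * 2 ^ (d choose 2) * (2 ^ l) ^ d"
    by (intro mult_left_mono power_mono le) auto
  also have "\<dots> = n ^ q * (2 ^ (q choose 2) * 2 ^ (l + d choose 2))"
    by (simp add: choose_two_add power_add mult_ac flip: power_mult)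
  also have "l + d = n - q" using n m by simp
  finally show ?thesis using n m by simp
qed

lemma sum_half_powers_le:
  assumes "finite A" "inj_on f A"
  shows "(\<Sum>k\<in>A. (1 / 2 :: real) ^ f k) \<le> 2"
proof -
  have "(\<Sum>k\<in>A. (1 / 2 :: real) ^ f k) = (\<Sum>i\<in>f ` A. (1 / 2) ^ i)"
    using assms(2) by (simp add: sum.reindex)
  also have "\<dots> \<le> (\<Sum>i. (1 / 2) ^ i)"
    using assms(1) by (intro sum_le_suminf) (auto simp: summable_geometric)
  also have "\<dots> = 2" by (simp add: suminf_geometric)
  finally show ?thesis .
qed

text \<open>
  The terms are bounded by two geometric progressions that decrease from the ends of the range
  towards the middle, so the sum has the order of its first term \<open>k = q\<close>.
\<close>
lemma balanced_cuts_bigo: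
  "(\<lambda>n. \<Sum>k=q..n - q. real (n choose k) * (2 ^ (k choose 2) * 2 ^ (n - k choose 2)))
     \<in> O(\<lambda>n. real n ^ q * 2 ^ (n - q choose 2))"
proof (rule bigoI)
  have "eventually (\<lambda>n. (2 * real n)\<^sup>2 * 4 ^ q \<le> 2 ^ n) sequentially" by real_asymp
  then show "eventually (\<lambda>n. norm (\<Sum>k=q..n - q. real (n choose k) * (2 ^ (k choose 2) * 2 ^ (n - k choose 2)))
      \<le> (4 * 2 ^ (q choose 2)) * norm (real n ^ q * 2 ^ (n - q choose 2))) sequentially"
  proof eventually_elim
    case (elim n)
    then have "real ((2 * n)\<^sup>2 * 4 ^ q) \<le> real (2 ^ n)" by simp
    then have big: "(2 * n)\<^sup>2 * 4 ^ q \<le> 2 ^ n" by (simp only: of_nat_le_iff)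
    define M where "M = real n ^ q * (2 ^ (q choose 2) * 2 ^ (n - q choose 2))"
    define t where "t k = real (n choose k) * (2 ^ (k choose 2) * 2 ^ (n - k choose 2))" for k
    have small: "t m \<le> M * (1 / 2) ^ (m - q)" if "q \<le> m" "2 * m \<le> n" for m
    proof -
      have "t m * 2 ^ (m - q) \<le> M"
        using of_nat_mono[OF balanced_cut_term_le[OF that big], where 'a = real]
        by (simp add: t_def M_def)
      then show ?thesis by (simp add: power_one_over field_simps)
    qed
    have "M \<ge> 0" by (simp add: M_def)
    have "t k \<le> M * (1 / 2) ^ (k - q) + M * (1 / 2) ^ (n - q - k)" if "k \<in> {q..n - q}" for k
    \<comment> \<open>The terms for \<open>k\<close> and \<open>n - k\<close> agree, so the estimate for the smaller side applies to both.\<close>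
    proof (cases "2 * k \<le> n")
      case True
      have "0 \<le> M * (1 / 2) ^ (n - q - k)" using \<open>M \<ge> 0\<close> by simp
      then show ?thesis using small[of k] True that by simp
    next
      case False
      have "k \<le> n" using that by auto
      then have "t k = t (n - k)"
        using binomial_symmetric[of k n] by (simp add: t_def mult_ac)
      moreover have "n - k - q = n - q - k" by simp
      moreover have "q \<le> n - k" "2 * (n - k) \<le> n" using that False by auto
      ultimately have "t k \<le> M * (1 / 2) ^ (n - q - k)"
        using small[of "n - k"] by simp
      moreover have "0 \<le> M * (1 / 2) ^ (k - q)" using \<open>M \<ge> 0\<close> by simp
      ultimately show ?thesis by simp
    qed
    then have "(\<Sum>k=q..n - q. t k) \<le> (\<Sum>k=q..n - q. M * (1 / 2) ^ (k - q) + M * (1 / 2) ^ (n - q - k))"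
      by (intro sum_mono) auto
    also have "\<dots> = M * ((\<Sum>k=q..n - q. (1 / 2) ^ (k - q)) + (\<Sum>k=q..n - q. (1 / 2) ^ (n - q - k)))"
      by (simp add: sum.distrib sum_distrib_left distrib_left)
    also have "\<dots> \<le> M * (2 + 2)"
      using \<open>M \<ge> 0\<close>
      by (intro mult_left_mono add_mono sum_half_powers_le) (auto simp: inj_on_def)
    finally have "(\<Sum>k=q..n - q. t k) \<le> 4 * M" by simp
    moreover have "(\<Sum>k=q..n - q. t k) \<ge> 0" by (intro sum_nonneg) (simp add: t_def)
    ultimately show ?case by (simp add: M_def t_def mult_ac)
  qed
qed

text \<open>
  Almost every graph consists of a connected graph on \<open>n - j\<close> vertices and an arbitrary graph on
  the \<open>j\<close> others, with \<open>j < q\<close>.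
\<close>
lemma giant_component_expansion:
  assumes "1 \<le> q"
  shows "(\<lambda>n. 2 ^ (n choose 2) -
      (\<Sum>j<q. real (n choose j) * 2 ^ (j choose 2) * real (num_irreducible True (n - j))))
    \<in> O(\<lambda>n. real n ^ q * 2 ^ (n - q choose 2))"
proof (rule landau_o.big_trans[OF bigoI[where c = 1] balanced_cuts_bigo])
  show "eventually (\<lambda>n. norm (2 ^ (n choose 2) -
        (\<Sum>j<q. real (n choose j) * 2 ^ (j choose 2) * real (num_irreducible True (n - j))))
      \<le> 1 * norm (\<Sum>k=q..n - q. real (n choose k) * (2 ^ (k choose 2) * 2 ^ (n - k choose 2))))
    sequentially"
    using eventually_ge_at_top[of "3 * q"]
  proof eventually_elim
    case (elim n)
    define giant where "giant = (\<Sum>j<q. (n choose j) * (2 ^ (j choose 2) * num_irreducible True (n - j)))"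
    define cuts where "cuts = (\<Sum>k=q..n - q. (n choose k) * (2 ^ (k choose 2) * 2 ^ (n - k choose 2)))"
    have "giant \<le> 2 ^ (n choose 2)" "2 ^ (n choose 2) \<le> giant + cuts"
      using graph_giant_component_count[OF assms elim] by (simp_all only: giant_def cuts_def)
    then have "real giant \<le> real (2 ^ (n choose 2))" "real (2 ^ (n choose 2)) \<le> real (giant + cuts)"
      by (simp_all only: of_nat_le_iff)
    then have "\<bar>2 ^ (n choose 2) - real giant\<bar> \<le> \<bar>real cuts\<bar>" by simp
    then show ?case by (simp add: giant_def cuts_def mult.assoc)
  qed
qed

section \<open>Inverting the expansion\<close>

text \<open>
  The hypothesis says that \<open>d\<close> and \<open>g\<close> are inverse as exponential generating functions.  Both
  sums are cut off at total degree \<open>r\<close>, so after collecting the terms with \<open>k + j = s\<close> every inner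
  convolution is complete and vanishes for \<open>s > 0\<close>.
\<close>
lemma binomial_convolution_inversion:
  fixes g d c :: "nat \<Rightarrow> real"
  assumes inv: "\<And>s. (\<Sum>k\<le>s. real (s choose k) * d k * g (s - k)) = (if s = 0 then 1 else 0)"
    and "1 \<le> r" "r \<le> n"
  shows "(\<Sum>k<r. real (n choose k) * d k *
      (\<Sum>j<r - k. real (n - k choose j) * g j * c (n - k - j))) = c n"
proof -
  have "(\<Sum>k<r. real (n choose k) * d k * (\<Sum>j<r - k. real (n - k choose j) * g j * c (n - k - j))) =
      (\<Sum>(k, j)\<in>Sigma {..<r} (\<lambda>k. {..<r - k}).
         real (n choose k) * real (n - k choose j) * d k * g j * c (n - k - j))"
    by (subst sum.Sigma[symmetric]) (auto simp: sum_distrib_left mult_ac)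
  also have "Sigma {..<r} (\<lambda>k. {..<r - k}) = {(k, j). k + j < r}"
    by auto
  also have "(\<Sum>(k, j)\<in>{(k, j). k + j < r}.
         real (n choose k) * real (n - k choose j) * d k * g j * c (n - k - j)) =
      (\<Sum>s<r. \<Sum>k\<le>s. real (n choose k) * real (n - k choose (s - k)) * d k * g (s - k) * c (n - k - (s - k)))"
    by (rule sum.triangle_reindex)
  also have "\<dots> = (\<Sum>s<r. real (n choose s) * c (n - s) * (\<Sum>k\<le>s. real (s choose k) * d k * g (s - k)))"
    unfolding sum_distrib_left
  proof (intro sum.cong refl)
    fix s k assume s: "s \<in> {..<r}" and k: "k \<in> {..s}"
    have "real (n choose k) * real (n - k choose (s - k)) = real (n choose s) * real (s choose k)"
      using choose_mult[of k s n] s k \<open>r \<le> n\<close> by (simp flip: of_nat_mult)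
    moreover have "n - k - (s - k) = n - s" using s k \<open>r \<le> n\<close> by auto
    ultimately show "real (n choose k) * real (n - k choose (s - k)) * d k * g (s - k) * c (n - k - (s - k)) =
        real (n choose s) * c (n - s) * (real (s choose k) * d k * g (s - k))"
      by simp
  qed
  also have "\<dots> = (\<Sum>s<r. if s = 0 then c n else 0)"
    by (intro sum.cong) (auto simp: inv)
  also have "\<dots> = c n" using \<open>1 \<le> r\<close> by (simp add: sum.delta')
  finally show ?thesis .
qed

text \<open>
  Substitute the expansion of \<open>g (n - k)\<close> at order \<open>r - k\<close> into the sum over \<open>k\<close>.  The orders are
  chosen such that each error term, after multiplication by \<open>n choose k\<close>, is of the size
  \<open>n ^ r * g (n - r)\<close>, and such that the main terms recombine to \<open>c n\<close>.
\<close>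
lemma binomial_convolution_inversion_bigo:
  fixes g d c :: "nat \<Rightarrow> real"
  assumes inv: "\<And>s. (\<Sum>k\<le>s. real (s choose k) * d k * g (s - k)) = (if s = 0 then 1 else 0)"
    and expansion: "\<And>q. 1 \<le> q \<Longrightarrow>
      (\<lambda>n. g n - (\<Sum>j<q. real (n choose j) * g j * c (n - j))) \<in> O(\<lambda>n. real n ^ q * g (n - q))"
    and "1 \<le> r"
  shows "(\<lambda>n. c n - (\<Sum>k<r. real (n choose k) * d k * g (n - k))) \<in> O(\<lambda>n. real n ^ r * g (n - r))"
proof -
  \<comment> \<open>the error made by the expansion of order \<open>q\<close>\<close>
  define e where "e q n = g n - (\<Sum>j<q. real (n choose j) * g j * c (n - j))" for q n
  have summand: "(\<lambda>n. real (n choose k) * d k * e (r - k) (n - k)) \<in> O(\<lambda>n. real n ^ r * g (n - r))"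
    if "k < r" for k
  proof -
    have lim: "filterlim (\<lambda>n. n - k) at_top sequentially" by (rule filterlim_minus_const_nat_at_top)
    have "e (r - k) \<in> O(\<lambda>n. real n ^ (r - k) * g (n - (r - k)))"
      unfolding e_def using expansion[of "r - k"] that by simp
    then have "(\<lambda>n. e (r - k) (n - k)) \<in> O(\<lambda>n. real (n - k) ^ (r - k) * g (n - k - (r - k)))"
      using lim by (rule landau_o.big.compose)
    also have "(\<lambda>n. real (n - k) ^ (r - k) * g (n - k - (r - k))) \<in> O(\<lambda>n. real n ^ (r - k) * g (n - r))"
      using that by (intro landau_o.big.mult bigoI[where c = 1] always_eventually) (auto intro: power_mono)
    finally have e: "(\<lambda>n. e (r - k) (n - k)) \<in> O(\<lambda>n. real n ^ (r - k) * g (n - r))" .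
    have "(\<lambda>n. real (n choose k)) \<in> O(\<lambda>n. real n ^ k)"
    proof (rule bigoI[where c = 1])
      show "eventually (\<lambda>n. norm (real (n choose k)) \<le> 1 * norm (real n ^ k)) sequentially"
        using eventually_ge_at_top[of k]
        by eventually_elim (use binomial_le_pow in \<open>simp flip: of_nat_power\<close>)
    qed
    then have "(\<lambda>n. real (n choose k) * d k * e (r - k) (n - k)) \<in>
        O(\<lambda>n. real n ^ k * 1 * (real n ^ (r - k) * g (n - r)))"
      by (intro landau_o.big.mult e) auto
    also have "(\<lambda>n. real n ^ k * 1 * (real n ^ (r - k) * g (n - r))) = (\<lambda>n. real n ^ r * g (n - r))"
      using that by (simp flip: power_add mult.assoc)
    finally show ?thesis .
  qed
  have "eventually (\<lambda>n. - (\<Sum>k<r. real (n choose k) * d k * e (r - k) (n - k)) =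
      c n - (\<Sum>k<r. real (n choose k) * d k * g (n - k))) sequentially"
    using eventually_ge_at_top[of r]
  proof eventually_elim
    case (elim n)
    have "(\<Sum>k<r. real (n choose k) * d k * e (r - k) (n - k)) =
        (\<Sum>k<r. real (n choose k) * d k * g (n - k)) -
        (\<Sum>k<r. real (n choose k) * d k * (\<Sum>j<r - k. real (n - k choose j) * g j * c (n - k - j)))"
      by (simp add: e_def right_diff_distrib sum_subtractf)
    then show ?case
      using binomial_convolution_inversion[OF inv \<open>1 \<le> r\<close> elim, where c = c] by simp
  qed
  moreover have "(\<lambda>n. - (\<Sum>k<r. real (n choose k) * d k * e (r - k) (n - k))) \<in> O(\<lambda>n. real n ^ r * g (n - r))"
    using summand by (intro big_sum_in_bigo landau_o.big.uminus_in_iff[THEN iffD2]) auto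
  ultimately show ?thesis by (rule landau_o.big.in_cong[THEN iffD1])
qed

text \<open>
  The recurrence for tournaments in the form \<open>(1 - I) * G = 1\<close>.  The case distinction supplies the
  constant term of \<open>1 - I\<close>.
\<close>
lemma tournament_series_inverse:
  "(\<Sum>k\<le>s. real (s choose k) * (if k = 0 then 1 else - real (num_irreducible False k)) *
      2 ^ (s - k choose 2)) = (if s = 0 then 1 else 0)"
proof (cases "s = 0")
  case False
  have "(\<Sum>k\<le>s. real (s choose k) * (if k = 0 then 1 else - real (num_irreducible False k)) *
      2 ^ (s - k choose 2)) =
      2 ^ (s choose 2) - (\<Sum>k=1..s. real (s choose k) * (real (num_irreducible False k) * 2 ^ (s - k choose 2)))"
    by (simp add: atMost_atLeast0 sum.atLeast_Suc_atMost sum_negf mult.assoc)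
  also have "(\<Sum>k=1..s. real (s choose k) * (real (num_irreducible False k) * 2 ^ (s - k choose 2))) =
      real (\<Sum>k=1..s. (s choose k) * (num_irreducible False k * 2 ^ (s - k choose 2)))"
    by simp
  also have "\<dots> = 2 ^ (s choose 2)"
    using tournament_recurrence[of s] False by simp
  finally show ?thesis using False by simp
qed (simp add: binomial_eq_0)

text \<open>
  Graphs and tournaments on \<open>n\<close> vertices are equally many.  Hence the coefficients of \<open>1 - I\<close>, which
  come from tournaments, invert the expansion by giant components, which comes from graphs.
\<close>
lemma connected_count_expansion:
  assumes "1 \<le> r"
  shows "(\<lambda>n. real (num_irreducible True n) - (2 ^ (n choose 2) -
      (\<Sum>k=1..r - 1. real (num_irreducible False k) * real (n choose k) * 2 ^ (n - k choose 2))))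
    \<in> O(\<lambda>n. real n ^ r * 2 ^ (n - r choose 2))"
proof -
  let ?d = "\<lambda>k. if k = 0 then 1 else - real (num_irreducible False k)"
  have "(\<lambda>n. real (num_irreducible True n) - (\<Sum>k<r. real (n choose k) * ?d k * 2 ^ (n - k choose 2)))
    \<in> O(\<lambda>n. real n ^ r * 2 ^ (n - r choose 2))"
    using tournament_series_inverse giant_component_expansion assms
    by (rule binomial_convolution_inversion_bigo)
  moreover have "(\<Sum>k<r. real (n choose k) * ?d k * 2 ^ (n - k choose 2)) = 2 ^ (n choose 2) -
      (\<Sum>k=1..r - 1. real (num_irreducible False k) * real (n choose k) * 2 ^ (n - k choose 2))" for n
  proof -
    have "{..<r} = {0..r - 1}" using assms by auto
    then show ?thesis by (simp add: sum.atLeast_Suc_atMost sum_negf mult_ac)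
  qed
  ultimately show ?thesis by simp
qed

section \<open>Connected graphs and irreducible tournaments as irreducible arc sets\<close>

text \<open>
  The set of vertices reachable from a given vertex has no exit; conversely, no walk leaves a set
  without exit.
\<close>
lemma (in wf_digraph) strongly_connected_iff_irreducible_on:
  "strongly_connected G \<longleftrightarrow> irreducible_on (verts G) (arcs_ends G)"
proof
  assume sc: "strongly_connected G"
  show "irreducible_on (verts G) (arcs_ends G)"
    unfolding irreducible_on_def
  proof (intro conjI allI impI)
    show "verts G \<noteq> {}" using sc by (simp add: strongly_connected_def)
    fix T assume T: "T \<subseteq> verts G" "T \<noteq> {} \<and> T \<noteq> verts G"
    then obtain u v where "u \<in> T" "v \<in> verts G - T" by blast
    then have "u \<rightarrow>\<^sup>*\<^bsub>G\<^esub> v" using sc T unfolding strongly_connected_def by blast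
    then show "\<exists>u\<in>T. \<exists>v\<in>verts G - T. (u, v) \<in> arcs_ends G"
    proof (rule contrapos_pp)
      assume no_exit: "\<not> (\<exists>u\<in>T. \<exists>v\<in>verts G - T. (u, v) \<in> arcs_ends G)"
      have "w \<in> T" if "u \<rightarrow>\<^sup>*\<^bsub>G\<^esub> w" for w
        using that
      proof (induction rule: reachable_induct)
        case base
        show ?case by (rule \<open>u \<in> T\<close>)
      next
        case (step x y)
        then show ?case using no_exit adj_in_verts(2) by blast
      qed
      then show "\<not> u \<rightarrow>\<^sup>*\<^bsub>G\<^esub> v" using \<open>v \<in> verts G - T\<close> by blast
    qed
  qed
next
  assume irr: "irreducible_on (verts G) (arcs_ends G)"
  show "strongly_connected G"
    unfolding strongly_connected_def
  proof (intro conjI ballI)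
    show "verts G \<noteq> {}" using irr by (simp add: irreducible_on_def)
    fix u v assume u: "u \<in> verts G" and v: "v \<in> verts G"
    let ?T = "{w. u \<rightarrow>\<^sup>*\<^bsub>G\<^esub> w}"
    have "?T \<subseteq> verts G" by (auto dest: reachable_in_verts)
    moreover have "?T \<noteq> {}" using u by auto
    moreover have "\<not> (\<exists>x\<in>?T. \<exists>y\<in>verts G - ?T. (x, y) \<in> arcs_ends G)"
      by (auto dest: reachable_adj_trans)
    ultimately have "?T = verts G" using irr unfolding irreducible_on_def by blast
    then show "u \<rightarrow>\<^sup>*\<^bsub>G\<^esub> v" using v by blast
  qed
qed

lemma connected_labeled_graph_iff:
  assumes "G \<in> labeled_graphs n"
  shows "Digraph_Component.connected (with_proj G) \<longleftrightarrow> irreducible_on {1..n} (parcs G)"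
proof -
  interpret pair_graph G using assms by (simp add: labeled_graphs_def)
  have "mk_symmetric (with_proj G) = G"
    using assms by (intro pair_pre_digraph.equality) (auto simp: parcs_mk_symmetric labeled_graphs_iff dest: symD)
  then show ?thesis
    using strongly_connected_iff_irreducible_on assms
    by (simp add: Digraph_Component.connected_def labeled_graphs_iff)
qed

lemma labeled_graph_iff_arc_sets:
  "G \<in> labeled_graphs n \<longleftrightarrow> pverts G = {1..n} \<and> parcs G \<in> arc_sets True {1..n}"
proof -
  have "sym E \<longleftrightarrow> (\<forall>u\<in>V. \<forall>v\<in>V. u \<noteq> v \<longrightarrow> ((u, v) \<in> E \<longleftrightarrow> ((v, u) \<in> E \<longleftrightarrow> True)))" (is "_ \<longleftrightarrow> ?R")
    if E: "E \<subseteq> V \<times> V" "irrefl E" for V :: "nat set" and E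
  proof
    assume "sym E"
    then have "(u, v) \<in> E \<longleftrightarrow> (v, u) \<in> E" for u v by (meson symD)
    then show ?R by simp
  next
    assume R: ?R
    show "sym E"
    proof (rule symI)
      fix u v assume uv: "(u, v) \<in> E"
      then have "u \<in> V" "v \<in> V" "u \<noteq> v" using E by (auto simp: irrefl_def)
      then show "(v, u) \<in> E" using R uv by simp
    qed
  qed
  then show ?thesis unfolding labeled_graphs_iff arc_sets_def mem_Collect_eq by meson
qed

lemma irreducible_tournament_iff:
  assumes "finite (pverts G)"
  shows "irreducible_tournament G \<longleftrightarrow>
    parcs G \<in> arc_sets False (pverts G) \<and> irreducible_on (pverts G) (parcs G)"
proof -
  have "tournament G \<longleftrightarrow> parcs G \<in> arc_sets False (pverts G)"
  proof
    assume "tournament G"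
    then interpret tournament G .
    show "parcs G \<in> arc_sets False (pverts G)"
    proof (rule arc_setsI)
      fix u v assume "(u, v) \<in> parcs G"
      then show "u \<in> pverts G \<and> v \<in> pverts G \<and> u \<noteq> v"
        using in_arcsD1[of u v] in_arcsD2[of u v] pair_no_loops[of "(u, v)"] by simp
    next
      fix u v assume "u \<in> pverts G" "v \<in> pverts G" "u \<noteq> v"
      then show "(u, v) \<in> parcs G \<longleftrightarrow> ((v, u) \<in> parcs G \<longleftrightarrow> False)"
        using unique_arc[of u v] by simp
    qed
  next
    assume arcs: "parcs G \<in> arc_sets False (pverts G)"
    then have sub: "parcs G \<subseteq> pverts G \<times> pverts G" by (simp add: arc_sets_def)
    have fin: "finite (parcs G)" using finite_subset[OF sub] assms by simp
    show "tournament G"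
    proof (unfold_locales)
      fix u v assume "u \<in> pverts G" "v \<in> pverts G" "u \<noteq> v"
      then show "(u, v) \<in> parcs G \<longleftrightarrow> (v, u) \<notin> parcs G"
        using arc_setsD(2)[OF arcs, of u v] by simp
    qed (use sub fin arc_setsD(1)[OF arcs] assms in auto)
  qed
  moreover have "(\<forall>A B. A \<union> B = V \<and> A \<inter> B = {} \<and> A \<noteq> {} \<and> B \<noteq> {} \<longrightarrow>
        (\<exists>a\<in>A. \<exists>b\<in>B. (a, b) \<in> E) \<and> (\<exists>a\<in>A. \<exists>b\<in>B. (b, a) \<in> E)) \<longleftrightarrow>
      (\<forall>T\<subseteq>V. T \<noteq> {} \<and> T \<noteq> V \<longrightarrow> (\<exists>u\<in>T. \<exists>v\<in>V - T. (u, v) \<in> E))" (is "?L \<longleftrightarrow> ?R")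
    for V :: "'a set" and E
  proof
    assume L: ?L
    show ?R
    proof (intro allI impI)
      fix T assume "T \<subseteq> V" "T \<noteq> {} \<and> T \<noteq> V"
      then show "\<exists>u\<in>T. \<exists>v\<in>V - T. (u, v) \<in> E"
        using L[rule_format, of T "V - T"] by blast
    qed
  next
    assume R: ?R
    show ?L
    proof (intro allI impI)
      fix A B assume AB: "A \<union> B = V \<and> A \<inter> B = {} \<and> A \<noteq> {} \<and> B \<noteq> {}"
      then have "V - A = B" "V - B = A" "A \<subseteq> V" "B \<subseteq> V" "A \<noteq> V" "B \<noteq> V" by blast+
      then show "(\<exists>a\<in>A. \<exists>b\<in>B. (a, b) \<in> E) \<and> (\<exists>a\<in>A. \<exists>b\<in>B. (b, a) \<in> E)"
        using R[rule_format, of A] R[rule_format, of B] AB by blast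
    qed
  qed
  ultimately show ?thesis
    unfolding irreducible_tournament_def irreducible_on_def by simp
qed

lemma card_digraphs_conv_num_irreducible:
  "card {G :: nat pair_pre_digraph. pverts G = {1..n} \<and>
     parcs G \<in> arc_sets b {1..n} \<and> irreducible_on {1..n} (parcs G)} =
     num_irreducible b n"
  unfolding num_irreducible_def
proof (rule bij_betw_same_card)
  show "bij_betw parcs
      {G :: nat pair_pre_digraph. pverts G = {1..n} \<and>
        parcs G \<in> arc_sets b {1..n} \<and> irreducible_on {1..n} (parcs G)}
      {E \<in> arc_sets b {1..n}. irreducible_on {1..n} E}"
    by (rule bij_betw_byWitness[where f' = "\<lambda>E. \<lparr>pverts = {1..n}, parcs = E\<rparr>"]) auto
qed

lemma connected_prob_conv_num_irreducible:
  "connected_prob n = num_irreducible True n / 2 ^ (n choose 2)"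
proof -
  have "{G \<in> labeled_graphs n. Digraph_Component.connected (with_proj G)} =
      {G. pverts G = {1..n} \<and> (parcs G \<in> arc_sets True {1..n} \<and> irreducible_on {1..n} (parcs G))}"
    using connected_labeled_graph_iff[of _ n] labeled_graph_iff_arc_sets[of _ n] by blast
  then show ?thesis
    unfolding connected_prob_eq by (simp only: card_digraphs_conv_num_irreducible)
qed

lemma num_irreducible_tournaments_conv: "num_irreducible_tournaments k = num_irreducible False k"
proof -
  have "{G :: nat pair_pre_digraph. irreducible_tournament G \<and> pverts G = {1..k}} =
      {G. pverts G = {1..k} \<and> (parcs G \<in> arc_sets False {1..k} \<and> irreducible_on {1..k} (parcs G))}"
    using irreducible_tournament_iff by (metis (lifting) finite_atLeastAtMost)
  then show ?thesis
    unfolding num_irreducible_tournaments_def by (simp only: card_digraphs_conv_num_irreducible)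
qed

section \<open>The probability of connectedness\<close>

lemma two_power_choose_ratio:
  assumes "k \<le> n"
  shows "(2 :: real) ^ (n - k choose 2) / 2 ^ (n choose 2) = 2 ^ (k * (k + 1) div 2) / 2 ^ (n * k)"
proof -
  obtain m where n: "n = k + m" using assms le_Suc_ex by blast
  have square: "k * k = 2 * (k choose 2) + k"
    by (induction k) (simp_all add: numeral_2_eq_2)
  then have "k * (k + 1) = 2 * ((k choose 2) + k)" by simp
  then have "k * (k + 1) div 2 = (k choose 2) + k" by simp
  then have "(m choose 2) + n * k = (n choose 2) + k * (k + 1) div 2"
    using choose_two_add[of k m] square by (simp add: n algebra_simps)
  then have "(2 :: real) ^ (m choose 2) * 2 ^ (n * k) = 2 ^ (n choose 2) * 2 ^ (k * (k + 1) div 2)"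
    by (simp flip: power_add)
  then show ?thesis by (simp add: n field_simps)
qed

theorem theorem1:
  fixes r :: nat
  assumes "r \<ge> 1"
  shows "(\<lambda>n. connected_prob n -
            (1 - (\<Sum>k = 1..r - 1. real (num_irreducible_tournaments k) * real (n choose k) *
                    (2 ^ (k * (k + 1) div 2) / 2 ^ (n * k))))
          ) \<in> O(\<lambda>n. real n ^ r / 2 ^ (n * r))"
proof -
  define count_error where "count_error n = real (num_irreducible True n) - (2 ^ (n choose 2) -
      (\<Sum>k=1..r - 1. real (num_irreducible False k) * real (n choose k) * 2 ^ (n - k choose 2)))" for n
  have "count_error n / 2 ^ (n choose 2) = connected_prob n -
      (1 - (\<Sum>k = 1..r - 1. real (num_irreducible_tournaments k) * real (n choose k) *
        (2 ^ (k * (k + 1) div 2) / 2 ^ (n * k))))" for n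
  proof -
    have "real (num_irreducible False k) * real (n choose k) * 2 ^ (n - k choose 2) / 2 ^ (n choose 2) =
        real (num_irreducible_tournaments k) * real (n choose k) * (2 ^ (k * (k + 1) div 2) / 2 ^ (n * k))" for k
    proof (cases "k \<le> n")
      case True
      show ?thesis
        unfolding num_irreducible_tournaments_conv two_power_choose_ratio[OF True, symmetric] by simp
    qed (simp add: binomial_eq_0)
    then show ?thesis
      by (simp add: count_error_def connected_prob_conv_num_irreducible diff_divide_distrib sum_divide_distrib)
  qed
  moreover have "(\<lambda>n. count_error n / 2 ^ (n choose 2)) \<in> O(\<lambda>n. real n ^ r * 2 ^ (n - r choose 2) / 2 ^ (n choose 2))"
    using connected_count_expansion[OF assms] unfolding count_error_def by (intro landau_o.big.divide_right) auto
  moreover have "(\<lambda>n. real n ^ r * 2 ^ (n - r choose 2) / 2 ^ (n choose 2)) \<in> O(\<lambda>n. real n ^ r / 2 ^ (n * r))"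
  proof (rule bigoI[where c = "2 ^ (r * (r + 1) div 2)"])
    show "eventually (\<lambda>n. norm (real n ^ r * 2 ^ (n - r choose 2) / 2 ^ (n choose 2)) \<le>
        2 ^ (r * (r + 1) div 2) * norm (real n ^ r / 2 ^ (n * r))) sequentially"
      using eventually_ge_at_top[of r]
    proof eventually_elim
      case (elim n)
      have "real n ^ r * 2 ^ (n - r choose 2) / 2 ^ (n choose 2) = 2 ^ (r * (r + 1) div 2) * (real n ^ r / 2 ^ (n * r))"
        using two_power_choose_ratio[OF elim] by (simp only: times_divide_eq_right[symmetric]) simp
      then show ?case by simp
    qed
  qed
  ultimately show ?thesis by (simp add: landau_o.big_trans)
qed

end
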